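(* Let $X$ be an abstract state space. Suppose $A,B$ satisfy Kato's conditions and that the associated perturbed (Kato) semigroup $(V(t))_{t\ge0}$ is dishonest, and let $K$ be a bounded positive operator on $X$. Then the perturbed semigroup $(V_K(t))_{t\ge0}$ associated with $A-K$ (with domain $D(A)$) and $B$ is also dishonest.
   Context: An abstract state space is a real ordered Banach space $X$ with closed generating positive cone $X_+$ on which the norm is additive: $\|u+v\|=\|u\|+\|v\|$ for $u,v\in X_+$. $\Psi\in X^*$ is the linear functional with $\langle\Psi,u\rangle=\|u\|$ for $u\in X_+$. $D(A)_+=D(A)\cap X_+$, $R(\lambda,A)=(\lambda-A)^{-1}$. An operator $T$ is positive if $Tu\in X_+$ for all $u\in X_+$, and substochastic if it is positive and $\|Tu\|\le\|u\|$ for $u\in X_+$; a semigroup is substochastic if each of its operators is. Kato's conditions on $A,B$ with $D(A)\subseteq D(B)\subseteq X$: (1) $A$ generates a substochastic $C_0$-semigroup; (2) $Bu\ge0$ for $u\in D(A)_+$; (3) $\langle\Psi,(A+B)u\rangle\le0$ for all $u\in D(A)_+$. Here $A+B$ has domain $D(A)$. Kato's Theorem (known): under these conditions there is an extension $G$ of $A+B$ generating a substochastic $C_0$-semigroup $(V(t))_{t\ge0}$ (the perturbed, or Kato, semigroup), with $R(\lambda,G)u=\sum_{k\ge0}R(\lambda,A)(BR(\lambda,A))^ku$ for $\lambda>0$, $u\in X$; it is the minimal substochastic $C_0$-semigroup whose generator extends $A+B$. Definition of $(V_K(t))_{t\ge0}$: the author asserts that, when $K$ is a bounded positive operator and $A,B$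 satisfy Kato's conditions, $(A-K,D(A))$ also generates a substochastic semigroup and $A-K,B$ also satisfy Kato's conditions; $(V_K(t))_{t\ge0}$ denotes the perturbed semigroup that Kato's Theorem gives for the pair $A-K,B$. Honesty: put $a(u)=-\langle\Psi,Au+Bu\rangle$ for $u\in D(A)$ and define $\bar a:D(G)\to\mathbb R$ by $\bar a(R(\lambda,G)u)=\sum_{k\ge0}a\big(R(\lambda,A)(BR(\lambda,A))^ku\big)$, $u\in X$ (well defined and independent of $\lambda>0$). $(V(t))_{t\ge0}$ is honest if $\|V(t)u\|-\|u\|=-\bar a\big(\int_0^tV(s)u\,ds\big)$ for all $t\ge0$, $u\in X_+$; otherwise it is dishonest. For the pair $A-K,B$, honesty of $(V_K(t))_{t\ge0}$ is defined in the same way with $A-K$ in place of $A$.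
   Formalization: Adds the hypothesis that A−K generates a substochastic semigroup, which can fail for a bounded positive K (e.g. a summand R² with the 1-norm, A=B=0, K(x,y)=(y,0)); in that case V_K is not defined. *)

theory Defs
  imports "HOL-Analysis.Analysis"
begin

section \<open>Abstract state spaces\<close>

text \<open>The positive cone is \<open>{u. 0 \<le> u}\<close>; the order axioms (a proper convex cone compatible with
  the linear structure) come from the class \<open>ordered_real_vector\<close>.\<close>

class abstract_state_space = banach + ordered_real_vector +
  assumes closed_positive_cone: "closed {u. 0 \<le> u}"
    and generating_positive_cone: "\<exists>v w. 0 \<le> v \<and> 0 \<le> w \<and> u = v - w"
    and norm_add_positive: "0 \<le> u \<Longrightarrow> 0 \<le> v \<Longrightarrow> norm (u + v) = norm u + norm v"

definition Psi :: "'a::abstract_state_space \<Rightarrow> real" where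
  "Psi = (THE f. bounded_linear f \<and> (\<forall>u\<ge>0. f u = norm u))"

lemma Psi_ex1:
  "\<exists>!f. bounded_linear f \<and> (\<forall>u\<ge>0::'a::abstract_state_space. f u = norm u)"
proof (rule ex_ex1I)
  have diff_eq: "norm v - norm w = norm v' - norm w'"
    if "0 \<le> v" "0 \<le> w" "0 \<le> v'" "0 \<le> w'" "v - w = v' - w'" for v w v' w' :: 'a
  proof -
    have "v + w' = v' + w" using that(5) by (simp add: algebra_simps)
    then show ?thesis
      using norm_add_positive[OF that(1) that(4)] norm_add_positive[OF that(3) that(2)] by simp
  qed
  obtain p q :: "'a \<Rightarrow> 'a" where pq: "\<And>u. 0 \<le> p u" "\<And>u. 0 \<le> q u" "\<And>u. u = p u - q u"
    using generating_positive_cone by metis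
  define f where "f = (\<lambda>u. norm (p u) - norm (q u))"
  have f_eq: "f u = norm v - norm w" if "0 \<le> v" "0 \<le> w" "u = v - w" for u v w
    unfolding f_def using diff_eq[OF pq(1) pq(2) that(1,2)] pq(3) that(3) by metis
  have add: "f (u + v) = f u + f v" for u v
  proof -
    have "u + v = (p u + p v) - (q u + q v)"
      using pq(3)[of u] pq(3)[of v] by (simp add: algebra_simps)
    then have "f (u + v) = norm (p u + p v) - norm (q u + q v)"
      by (intro f_eq) (simp_all add: pq)
    then show ?thesis by (simp add: f_def norm_add_positive pq)
  qed
  have scale_pos: "f (r *\<^sub>R u) = r * f u" if "0 \<le> r" for r u
  proof -
    have "r *\<^sub>R u = r *\<^sub>R p u - r *\<^sub>R q u" using pq(3)[of u] by (metis scaleR_diff_right)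
    then have "f (r *\<^sub>R u) = norm (r *\<^sub>R p u) - norm (r *\<^sub>R q u)"
      by (intro f_eq) (simp_all add: pq that scaleR_nonneg_nonneg)
    then show ?thesis using that by (simp add: f_def algebra_simps)
  qed
  have neg: "f (- u) = - f u" for u
    using f_eq[of "q u" "p u" "- u"] pq by (simp add: f_def) (metis minus_diff_eq)
  have scale: "f (r *\<^sub>R u) = r * f u" for r u
  proof (cases "0 \<le> r")
    case False
    then have "f (- (r *\<^sub>R u)) = - r * f u" using scale_pos[of "- r" u] by simp
    then show ?thesis by (simp add: neg)
  qed (rule scale_pos)
  have bound: "norm (f u) \<le> norm u * 1" for u
    using norm_triangle_ineq3[of "p u" "q u"] pq(3)[of u] by (simp add: f_def)
  have "bounded_linear f"
    by (rule bounded_linear_intro[OF add _ bound]) (simp add: scale)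
  moreover have "f u = norm u" if "0 \<le> u" for u
    using f_eq[of u 0 u] that by simp
  ultimately show "\<exists>f. bounded_linear f \<and> (\<forall>u\<ge>0::'a. f u = norm u)" by blast
next
  fix f g :: "'a \<Rightarrow> real"
  assume f: "bounded_linear f \<and> (\<forall>u\<ge>0. f u = norm u)"
    and g: "bounded_linear g \<and> (\<forall>u\<ge>0. g u = norm u)"
  show "f = g"
  proof
    fix u :: 'a
    obtain v w where vw: "0 \<le> v" "0 \<le> w" "u = v - w" using generating_positive_cone by metis
    have lin: "linear f" "linear g" using f g by (auto dest: bounded_linear.linear)
    show "f u = g u" using f g vw by (simp add: linear_diff[OF lin(1)] linear_diff[OF lin(2)])
  qed
qed

lemma Psi_bounded_linear: "bounded_linear Psi"
  and Psi_positive: "0 \<le> u \<Longrightarrow> Psi u = norm u"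
  using theI'[OF Psi_ex1] unfolding Psi_def by auto

definition positive_op :: "('a::abstract_state_space \<Rightarrow> 'a) \<Rightarrow> bool" where
  "positive_op T \<longleftrightarrow> (\<forall>u\<ge>0. 0 \<le> T u)"

text \<open>The norm inequality is required on the positive cone only.\<close>

definition substochastic :: "('a::abstract_state_space \<Rightarrow> 'a) \<Rightarrow> bool" where
  "substochastic T \<longleftrightarrow> positive_op T \<and> (\<forall>u\<ge>0. norm (T u) \<le> norm u)"


section \<open>Unbounded operators\<close>

text \<open>A pair \<open>(D, f)\<close> stands for the operator with domain \<open>D\<close> acting as \<open>f\<close> on \<open>D\<close>; the values of
  \<open>f\<close> outside \<open>D\<close> are irrelevant, so operators are compared with \<open>op_eq\<close>, not with \<open>(=)\<close>.\<close>

type_synonym 'a operator = "'a set \<times> ('a \<Rightarrow> 'a)"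

abbreviation Dom :: "'a operator \<Rightarrow> 'a set" where "Dom \<equiv> fst"
abbreviation app :: "'a operator \<Rightarrow> 'a \<Rightarrow> 'a" where "app \<equiv> snd"

definition linear_op :: "'a::real_vector operator \<Rightarrow> bool" where
  "linear_op A \<longleftrightarrow> subspace (Dom A) \<and>
     (\<forall>u\<in>Dom A. \<forall>v\<in>Dom A. app A (u + v) = app A u + app A v) \<and>
     (\<forall>c. \<forall>u\<in>Dom A. app A (c *\<^sub>R u) = c *\<^sub>R app A u)"

definition op_extends :: "'a operator \<Rightarrow> 'a operator \<Rightarrow> bool" where
  "op_extends G A \<longleftrightarrow> Dom A \<subseteq> Dom G \<and> (\<forall>u\<in>Dom A. app G u = app A u)"

definition op_eq :: "'a operator \<Rightarrow> 'a operator \<Rightarrow> bool" where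
  "op_eq A G \<longleftrightarrow> Dom A = Dom G \<and> (\<forall>u\<in>Dom A. app A u = app G u)"

text \<open>Both operations keep the domain of the first operator; \<open>op_add\<close> is only used when
  \<open>Dom A \<subseteq> Dom B\<close>.\<close>

definition op_add :: "'a::real_vector operator \<Rightarrow> 'a operator \<Rightarrow> 'a operator" where
  "op_add A B = (Dom A, \<lambda>u. app A u + app B u)"

definition op_diff_bounded :: "'a::real_vector operator \<Rightarrow> ('a \<Rightarrow> 'a) \<Rightarrow> 'a operator" where
  "op_diff_bounded A K = (Dom A, \<lambda>u. app A u - K u)"

definition resolvent :: "real \<Rightarrow> 'a::real_vector operator \<Rightarrow> 'a \<Rightarrow> 'a" where
  "resolvent l A = the_inv_into (Dom A) (\<lambda>u. l *\<^sub>R u - app A u)"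


section \<open>Semigroups and generators\<close>

text \<open>Only the values \<open>T t\<close> with \<open>t \<ge> 0\<close> are relevant.\<close>

definition C0_semigroup :: "(real \<Rightarrow> 'a::banach \<Rightarrow> 'a) \<Rightarrow> bool" where
  "C0_semigroup T \<longleftrightarrow> (\<forall>t\<ge>0. bounded_linear (T t)) \<and> (\<forall>u. T 0 u = u) \<and>
     (\<forall>s\<ge>0. \<forall>t\<ge>0. \<forall>u. T (s + t) u = T s (T t u)) \<and>
     (\<forall>u. ((\<lambda>t. T t u) \<longlongrightarrow> u) (at_right 0))"

definition generator :: "(real \<Rightarrow> 'a::banach \<Rightarrow> 'a) \<Rightarrow> 'a operator" where
  "generator T =
     ({u. \<exists>v. ((\<lambda>t. (T t u - u) /\<^sub>R t) \<longlongrightarrow> v) (at_right 0)},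
      \<lambda>u. Lim (at_right 0) (\<lambda>t. (T t u - u) /\<^sub>R t))"

definition substochastic_semigroup :: "(real \<Rightarrow> 'a::abstract_state_space \<Rightarrow> 'a) \<Rightarrow> bool" where
  "substochastic_semigroup T \<longleftrightarrow> C0_semigroup T \<and> (\<forall>t\<ge>0. substochastic (T t))"

definition generates_substochastic :: "'a::abstract_state_space operator \<Rightarrow> bool" where
  "generates_substochastic A \<longleftrightarrow> (\<exists>T. substochastic_semigroup T \<and> op_eq A (generator T))"


section \<open>Kato's conditions, the perturbed semigroup and honesty\<close>

definition kato_conditions ::
    "'a::abstract_state_space operator \<Rightarrow> 'a operator \<Rightarrow> bool" where
  "kato_conditions A B \<longleftrightarrow>
     linear_op A \<and> linear_op B \<and> Dom A \<subseteq> Dom B \<and>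
     generates_substochastic A \<and>
     (\<forall>u\<in>Dom A. 0 \<le> u \<longrightarrow> 0 \<le> app B u) \<and>
     (\<forall>u\<in>Dom A. 0 \<le> u \<longrightarrow> Psi (app (op_add A B) u) \<le> 0)"

definition kato_term ::
    "real \<Rightarrow> 'a::abstract_state_space operator \<Rightarrow> 'a operator \<Rightarrow> nat \<Rightarrow> 'a \<Rightarrow> 'a" where
  "kato_term l A B k u = resolvent l A (((\<lambda>v. app B (resolvent l A v)) ^^ k) u)"

text \<open>The semigroup that Kato's theorem attaches to the pair \<open>A, B\<close>. The resolvent series determines
  \<open>V t\<close> uniquely for \<open>t \<ge> 0\<close>.\<close>

definition perturbed_semigroup ::
    "'a::abstract_state_space operator \<Rightarrow> 'a operator \<Rightarrow> (real \<Rightarrow> 'a \<Rightarrow> 'a) \<Rightarrow> bool" where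
  "perturbed_semigroup A B V \<longleftrightarrow>
     substochastic_semigroup V \<and> op_extends (generator V) (op_add A B) \<and>
     (\<forall>l>0. \<forall>u. (\<lambda>k. kato_term l A B k u) sums resolvent l (generator V) u)"

definition loss :: "'a::abstract_state_space operator \<Rightarrow> 'a operator \<Rightarrow> 'a \<Rightarrow> real" where
  "loss A B u = - Psi (app A u + app B u)"

text \<open>The extension of \<open>loss A B\<close> to the domain of the generator of the perturbed semigroup \<open>V\<close>;
  the description covers all \<open>l > 0\<close> because the value does not depend on \<open>l\<close>.\<close>

definition loss_ext ::
    "'a::abstract_state_space operator \<Rightarrow> 'a operator \<Rightarrow> (real \<Rightarrow> 'a \<Rightarrow> 'a) \<Rightarrow> 'a \<Rightarrow> real" where
  "loss_ext A B V v =
     (THE r. \<forall>l>0. \<forall>u. v = resolvent l (generator V) u \<longrightarrow>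
        (\<lambda>k. loss A B (kato_term l A B k u)) sums r)"

definition honest ::
    "'a::abstract_state_space operator \<Rightarrow> 'a operator \<Rightarrow> (real \<Rightarrow> 'a \<Rightarrow> 'a) \<Rightarrow> bool" where
  "honest A B V \<longleftrightarrow>
     (\<forall>t\<ge>0. \<forall>u\<ge>0. norm (V t u) - norm u = - loss_ext A B V (integral {0..t} (\<lambda>s. V s u)))"

abbreviation dishonest ::
    "'a::abstract_state_space operator \<Rightarrow> 'a operator \<Rightarrow> (real \<Rightarrow> 'a \<Rightarrow> 'a) \<Rightarrow> bool" where
  "dishonest A B V \<equiv> \<not> honest A B V"

text \<open>For a bounded positive \<open>K\<close> all of Kato's conditions pass from \<open>A, B\<close> to \<open>A - K, B\<close>, except
  that \<open>A - K\<close> need not generate a positive semigroup: on the plane with the 1-norm take \<open>A = B = 0\<close>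
  and \<open>K (x, y) = (y, 0)\<close>, so that \<open>exp (- t K) (x, y) = (x - t y, y)\<close>. Generation by \<open>A - K\<close> is
  therefore a hypothesis whenever the perturbed semigroup of \<open>A - K, B\<close> is considered.\<close>

lemma kato_conditions_diff_bounded:
  assumes "kato_conditions A B" "bounded_linear K" "positive_op K"
    and "generates_substochastic (op_diff_bounded A K)"
  shows "kato_conditions (op_diff_bounded A K) B"
proof -
  have "linear K" using assms(2) by (rule bounded_linear.linear)
  then have "linear_op (op_diff_bounded A K)"
    using assms(1) unfolding kato_conditions_def linear_op_def op_diff_bounded_def
    by (auto simp: linear_add linear_scale algebra_simps)
  moreover have "Psi (app (op_add (op_diff_bounded A K) B) u) \<le> 0" if "u \<in> Dom A" "0 \<le> u" for u
  proof -
    have "app (op_add (op_diff_bounded A K) B) u = app (op_add A B) u - K u"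
      by (simp add: op_add_def op_diff_bounded_def)
    then have "Psi (app (op_add (op_diff_bounded A K) B) u) = Psi (app (op_add A B) u) - Psi (K u)"
      using linear_diff[OF bounded_linear.linear[OF Psi_bounded_linear]] by metis
    moreover have "0 \<le> Psi (K u)"
      using assms(3) that by (simp add: positive_op_def Psi_positive)
    moreover have "Psi (app (op_add A B) u) \<le> 0"
      using assms(1) that unfolding kato_conditions_def by blast
    ultimately show ?thesis by linarith
  qed
  moreover have "Dom (op_diff_bounded A K) = Dom A" by (simp add: op_diff_bounded_def)
  ultimately show ?thesis using assms unfolding kato_conditions_def by auto
qed

end

theory Submission
  imports Defs
begin

text \<open>Put \<open>L = B R(l,A)\<close> and let \<open>c(u) = lim \<langle>\<Psi>, L\<^sup>n u\<rangle>\<close>. Telescoping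
  \<open>\<langle>\<Psi>, L v\<rangle> = \<langle>\<Psi>, v\<rangle> - l \<langle>\<Psi>, R(l,A) v\<rangle> - a(R(l,A) v)\<close> along the resolvent series shows that the
  extended loss functional falls short of \<open>-\<langle>\<Psi>, G v\<rangle>\<close> by exactly \<open>c((l - G) v)\<close>, so honesty means
  \<open>c = 0\<close>. On the cone, \<open>c\<close> is the largest \<open>L\<close>-invariant functional below \<open>\<Psi>\<close>. If the semigroup of
  \<open>A - K, B\<close>, with generator \<open>G'\<close>, is honest, the functional \<open>u \<mapsto> c(u - K R(l,G') u)\<close>, which is
  invariant under \<open>B R(l,A-K)\<close> and lies below \<open>\<Psi>\<close>, is therefore \<open>\<le> 0\<close>; hence \<open>c \<le> c \<circ> K R(l,G')\<close>,
  and iteration with \<open>l > \<parallel>K\<parallel>\<close> gives \<open>c = 0\<close>.\<close>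

section \<open>Decomposition into positive elements\<close>

lemma linear_Psi: "linear Psi"
  by (rule bounded_linear.linear[OF Psi_bounded_linear])

lemma Psi_add: "Psi (u + v) = Psi u + Psi v"
  and Psi_diff: "Psi (u - v) = Psi u - Psi v"
  and Psi_scaleR: "Psi (r *\<^sub>R u) = r * Psi u"
  by (simp_all add: linear_add[OF linear_Psi] linear_diff[OF linear_Psi] linear_scale[OF linear_Psi])

lemma Psi_nonneg: "0 \<le> u \<Longrightarrow> 0 \<le> Psi u"
  by (simp add: Psi_positive)

lemma generating_cone_obtain:
  fixes u :: "'a::abstract_state_space"
  obtains v w where "0 \<le> v" "0 \<le> w" "u = v - w"
  using generating_positive_cone by metis

lemma linear_eq_on_cone:
  fixes f g :: "'a::abstract_state_space \<Rightarrow> 'b::real_vector"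
  assumes "linear f" "linear g" "\<And>u. 0 \<le> u \<Longrightarrow> f u = g u"
  shows "f u = g u"
proof -
  obtain v w where "0 \<le> v" "0 \<le> w" "u = v - w" by (rule generating_cone_obtain)
  then show ?thesis using assms by (simp add: linear_diff)
qed

lemma sums_cone_nonneg:
  fixes f :: "nat \<Rightarrow> 'a::abstract_state_space"
  assumes "f sums s" "\<And>n. 0 \<le> f n"
  shows "0 \<le> s"
proof -
  have "s \<in> {u. 0 \<le> u}"
    by (rule Lim_in_closed_set[OF closed_positive_cone _ _ assms(1)[unfolded sums_def]])
      (simp_all add: sum_nonneg assms(2))
  then show ?thesis by simp
qed

text \<open>Riemann sums of cone-valued functions lie in the cone and approximate the integral, so
  closedness of the cone suffices.\<close>

lemma integral_cone_nonneg:
  fixes f :: "real \<Rightarrow> 'a::abstract_state_space"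
  assumes "f integrable_on {a..b}" "\<And>s. s \<in> {a..b} \<Longrightarrow> 0 \<le> f s"
  shows "0 \<le> integral {a..b} f"
proof -
  have "integral {a..b} f \<in> closure {u. 0 \<le> u}"
    unfolding closure_approachable
  proof (intro allI impI)
    fix e :: real assume "0 < e"
    with integrable_integral[OF assms(1)] obtain g where g: "gauge g"
      "\<And>D. D tagged_division_of {a..b} \<Longrightarrow> g fine D \<Longrightarrow>
        norm ((\<Sum>(x,k)\<in>D. Henstock_Kurzweil_Integration.content k *\<^sub>R f x) - integral {a..b} f) < e"
      unfolding has_integral_real by meson
    obtain D where D: "D tagged_division_of {a..b}" "g fine D"
      using fine_division_exists_real[OF g(1)] by blast
    have "0 \<le> (\<Sum>(x,k)\<in>D. Henstock_Kurzweil_Integration.content k *\<^sub>R f x)"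
      using tagged_division_ofD(2,3)[OF D(1)]
      by (intro sum_nonneg) (clarsimp, blast intro: scaleR_nonneg_nonneg assms(2) content_pos_le)
    then show "\<exists>y\<in>{u. 0 \<le> u}. dist y (integral {a..b} f) < e"
      using g(2)[OF D] by (auto simp: dist_norm)
  qed
  then show ?thesis unfolding closure_closed[OF closed_positive_cone] by simp
qed

text \<open>The Baire category theorem makes the closure of the differences of the positive half-ball a
  neighbourhood of \<open>0\<close>; successive approximation then removes the closure.\<close>

lemma approximate_decomposition:
  obtains r where "0 < r"
    "\<And>(u::'a::abstract_state_space) e. norm u < r \<Longrightarrow> 0 < e \<Longrightarrow>
      \<exists>v\<ge>0. \<exists>w\<ge>0. norm v \<le> 1 \<and> norm w \<le> 1 \<and> norm (u - (v - w)) < e"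
proof -
  define D :: "real \<Rightarrow> 'a set" where
    "D = (\<lambda>a. {v - w | v w. 0 \<le> v \<and> 0 \<le> w \<and> norm v \<le> a \<and> norm w \<le> a})"
  have "\<exists>n::nat. interior (closure (D n)) \<noteq> {}"
  proof (rule ccontr)
    assume *: "\<not> ?thesis"
    have "euclidean interior_of \<Union>(range (\<lambda>n::nat. closure (D n))) = {}"
      by (rule Baire_category_alt) (use * in \<open>auto simp: completely_metrizable_space_euclidean\<close>)
    moreover have "\<Union>(range (\<lambda>n::nat. closure (D n))) = UNIV"
    proof -
      have "\<exists>n::nat. u \<in> D n" for u
      proof -
        obtain v w where vw: "0 \<le> v" "0 \<le> w" "u = v - w" by (rule generating_cone_obtain)
        obtain n :: nat where "max (norm v) (norm w) \<le> n" using real_arch_simple by blast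
        with vw have "u \<in> D n" unfolding D_def by auto
        then show ?thesis ..
      qed
      then show ?thesis using closure_subset by blast
    qed
    ultimately show False by simp
  qed
  then obtain n :: nat and x where "x \<in> interior (closure (D n))" by blast
  then obtain s where s: "0 < s" "ball x s \<subseteq> closure (D n)"
    by (auto simp: mem_interior)
  define r where "r = s / (2 * (real n + 1))"
  have "0 < r" using s by (simp add: r_def)
  moreover have "\<exists>v\<ge>0. \<exists>w\<ge>0. norm v \<le> 1 \<and> norm w \<le> 1 \<and> norm (u - (v - w)) < e"
    if u: "norm u < r" and e: "0 < e" for u :: 'a and e
  proof -
    \<comment> \<open>\<open>n\<close> may be \<open>0\<close>, hence \<open>n + 1\<close>. Both
      \<open>x + 2 N u\<close> and \<open>x\<close> lie in the ball; approximating each within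
      \<open>e N\<close> and dividing the difference by \<open>2 N\<close> approximates
      \<open>u\<close> within \<open>e\<close>.\<close>
    define N where "N = real n + 1"
    have N: "0 < N" "real n \<le> N" by (simp_all add: N_def)
    have "x + (2 * N) *\<^sub>R u \<in> ball x s" "x \<in> ball x s"
      using u s N by (simp_all add: r_def dist_norm pos_less_divide_eq mult.commute flip: N_def)
    then have "x + (2 * N) *\<^sub>R u \<in> closure (D n)" "x \<in> closure (D n)" using s(2) by blast+
    then obtain y z where y: "y \<in> D n" "dist y (x + (2 * N) *\<^sub>R u) < e * N"
      and z: "z \<in> D n" "dist z x < e * N"
      using e N unfolding closure_approachable by (metis mult_pos_pos)
    obtain a b where ab: "0 \<le> a" "0 \<le> b" "norm a \<le> n" "norm b \<le> n" "y = a - b"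
      using y(1) unfolding D_def by blast
    obtain c d where cd: "0 \<le> c" "0 \<le> d" "norm c \<le> n" "norm d \<le> n" "z = c - d"
      using z(1) unfolding D_def by blast
    let ?v = "(1 / (2 * N)) *\<^sub>R (a + d)" and ?w = "(1 / (2 * N)) *\<^sub>R (b + c)"
    have v: "0 \<le> ?v" and w: "0 \<le> ?w"
      using ab cd N by (auto intro!: scaleR_nonneg_nonneg add_nonneg_nonneg)
    have le1: "norm ((1 / (2 * N)) *\<^sub>R (p + q)) \<le> 1" if "norm p \<le> n" "norm q \<le> n" for p q :: "'a"
    proof -
      have "norm (p + q) \<le> 2 * N" using norm_triangle_ineq[of p q] that N(2) by linarith
      then show ?thesis using N(1) by simp
    qed
    have "u - (?v - ?w) = (1 / (2 * N)) *\<^sub>R ((x + (2 * N) *\<^sub>R u - y) - (x - z))"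
    proof -
      have "(1 / (2 * N)) *\<^sub>R (2 * N) *\<^sub>R u = u" using N by simp
      then have "(1 / (2 * N)) *\<^sub>R ((x + (2 * N) *\<^sub>R u - y) - (x - z)) = u - (1 / (2 * N)) *\<^sub>R (y - z)"
        by (simp add: scaleR_diff_right scaleR_add_right)
      then show ?thesis by (simp add: ab(5) cd(5) scaleR_diff_right scaleR_add_right)
    qed
    then have "norm (u - (?v - ?w)) \<le> 1 / (2 * N) * (dist y (x + (2 * N) *\<^sub>R u) + dist z x)"
      using N norm_triangle_ineq4[of "x + (2 * N) *\<^sub>R u - y" "x - z"]
      by (simp add: dist_norm norm_minus_commute divide_right_mono)
    also have "\<dots> < 1 / (2 * N) * (e * N + e * N)"
      using y(2) z(2) N by (intro mult_strict_left_mono add_strict_mono) auto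
    also have "\<dots> = e" using N by simp
    finally have "norm (u - (?v - ?w)) < e" .
    then show ?thesis
      using v w le1[OF ab(3) cd(4)] le1[OF ab(4) cd(3)] by (intro exI[of _ ?v] exI[of _ ?w] conjI)
  qed
  ultimately show thesis by (rule that)
qed

lemma bounded_decomposition:
  obtains M where "0 < M"
    "\<And>u::'a::abstract_state_space.
      \<exists>v\<ge>0. \<exists>w\<ge>0. u = v - w \<and> norm v \<le> M * norm u \<and> norm w \<le> M * norm u"
proof -
  obtain r where r: "0 < r" and approx: "\<And>(u::'a) e. norm u < r \<Longrightarrow> 0 < e \<Longrightarrow>
      \<exists>v\<ge>0. \<exists>w\<ge>0. norm v \<le> 1 \<and> norm w \<le> 1 \<and> norm (u - (v - w)) < e"
    by (rule approximate_decomposition) (rule that)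
  obtain p q :: "'a \<Rightarrow> 'a" where pq: "\<And>u. norm u < r \<Longrightarrow>
      0 \<le> p u \<and> 0 \<le> q u \<and> norm (p u) \<le> 1 \<and> norm (q u) \<le> 1 \<and> norm (u - (p u - q u)) < r / 2"
    using approx[of _ "r / 2"] r by (metis half_gt_zero)
  have small: "\<exists>v\<ge>0. \<exists>w\<ge>0. u = v - w \<and> norm v \<le> 2 \<and> norm w \<le> 2" if u: "norm u < r" for u :: 'a
  proof -
    \<comment> \<open>\<open>e n\<close> is the remainder after \<open>n\<close> corrections,
      magnified by \<open>2^n\<close>: an error below \<open>r / 2\<close> doubles and stays below
      \<open>r\<close>. The corrections carry weights \<open>(1/2)^n\<close>, whence the bound
      \<open>2\<close>.\<close>
    define e where "e = rec_nat u (\<lambda>_ x. 2 *\<^sub>R (x - (p x - q x)))"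
    have e0: "e 0 = u" and eS: "e (Suc n) = 2 *\<^sub>R (e n - (p (e n) - q (e n)))" for n
      by (simp_all add: e_def)
    have en: "norm (e n) < r" for n
    proof (induction n)
      case (Suc n)
      then show ?case using pq[OF Suc] by (simp add: eS)
    qed (simp add: e0 u)
    define a b where "a = (\<lambda>n. (1/2)^n *\<^sub>R p (e n))" and "b = (\<lambda>n. (1/2)^n *\<^sub>R q (e n))"
    have ab: "0 \<le> a n" "0 \<le> b n" "norm (a n) \<le> (1/2)^n" "norm (b n) \<le> (1/2)^n" for n
      using pq[OF en[of n]] by (auto simp: a_def b_def scaleR_nonneg_nonneg mult_left_le)
    have geo: "(\<lambda>n. (1/2::real)^n) sums 2" using geometric_sums[of "1/2::real"] by simp
    have nsum: "summable (\<lambda>n. norm (a n))" "summable (\<lambda>n. norm (b n))"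
      using ab by (auto intro!: summable_comparison_test'[OF sums_summable[OF geo], of 0])
    have sums: "a sums suminf a" "b sums suminf b"
      using nsum summable_norm_cancel summable_sums by blast+
    have "norm (suminf a) \<le> 2" "norm (suminf b) \<le> 2"
      using summable_norm[OF nsum(1)] suminf_le[OF ab(3) nsum(1) sums_summable[OF geo]]
        summable_norm[OF nsum(2)] suminf_le[OF ab(4) nsum(2) sums_summable[OF geo]] sums_unique[OF geo]
      by simp_all
    moreover have "0 \<le> suminf a" "0 \<le> suminf b"
      using sums_cone_nonneg sums ab by blast+
    moreover have "u = suminf a - suminf b"
    proof -
      have part: "(\<Sum>k<n. a k - b k) = u - (1/2)^n *\<^sub>R e n" for n
      proof (induction n)
        case (Suc n)
        then show ?case by (simp add: eS a_def b_def algebra_simps)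
      qed (simp add: e0)
      have "(\<lambda>n. (1/2)^n *\<^sub>R e n) \<longlonglongrightarrow> 0"
      proof (rule Lim_null_comparison)
        show "\<forall>\<^sub>F n in sequentially. norm ((1/2)^n *\<^sub>R e n) \<le> (1/2)^n * r"
          using en by (intro always_eventually allI) (simp add: less_imp_le)
        show "(\<lambda>n. (1/2)^n * r) \<longlonglongrightarrow> 0" by (rule tendsto_mult_left_zero) (simp add: LIMSEQ_power_zero)
      qed
      then have "(\<lambda>n. u - (1/2)^n *\<^sub>R e n) \<longlonglongrightarrow> u - 0" by (intro tendsto_intros)
      then have "(\<lambda>k. a k - b k) sums u" by (simp add: sums_def part)
      then show ?thesis using sums_diff[OF sums] sums_unique2 by blast
    qed
    ultimately show ?thesis by blast
  qed
  have "\<exists>v\<ge>0. \<exists>w\<ge>0. u = v - w \<and> norm v \<le> 4 / r * norm u \<and> norm w \<le> 4 / r * norm u" for u :: 'a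
  proof (cases "u = 0")
    case False
    \<comment> \<open>This scaling gives \<open>u / s\<close> the norm \<open>r / 2\<close>; the
      bound \<open>2\<close> then becomes \<open>2 s = 4 / r * norm u\<close>.\<close>
    define s where "s = 2 * norm u / r"
    have s: "0 < s" using False r by (simp add: s_def)
    have "norm ((1 / s) *\<^sub>R u) < r" using False r by (simp add: s_def)
    then obtain v w where vw: "0 \<le> v" "0 \<le> w" "(1 / s) *\<^sub>R u = v - w" "norm v \<le> 2" "norm w \<le> 2"
      using small by blast
    have "u = s *\<^sub>R v - s *\<^sub>R w"
      using s by (simp add: vw(3)[symmetric] flip: scaleR_diff_right)
    moreover have "norm (s *\<^sub>R v) \<le> 4 / r * norm u" "norm (s *\<^sub>R w) \<le> 4 / r * norm u"
      using s vw r False by (simp_all add: s_def field_simps)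
    ultimately show ?thesis using s vw(1,2)
      by (intro exI[of _ "s *\<^sub>R v"] exI[of _ "s *\<^sub>R w"] conjI scaleR_nonneg_nonneg) auto
  qed auto
  with r show thesis by (intro that[of "4 / r"]) auto
qed

text \<open>A bounded decomposition carries the estimate over to the whole space. Laplace transforms
  and defect functionals, estimated only on the cone, become continuous this way.\<close>

lemma bounded_linear_if_bounded_on_cone:
  fixes f :: "'a::abstract_state_space \<Rightarrow> 'b::real_normed_vector"
  assumes "linear f" "\<And>u. 0 \<le> u \<Longrightarrow> norm (f u) \<le> C * norm u"
  shows "bounded_linear f"
proof -
  obtain M where M: "0 < M"
    "\<And>u::'a. \<exists>v\<ge>0. \<exists>w\<ge>0. u = v - w \<and> norm v \<le> M * norm u \<and> norm w \<le> M * norm u"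
    by (rule bounded_decomposition) (rule that)
  have "norm (f u) \<le> norm u * (2 * M * \<bar>C\<bar>)" for u
  proof -
    obtain v w where vw: "0 \<le> v" "0 \<le> w" "u = v - w" "norm v \<le> M * norm u" "norm w \<le> M * norm u"
      using M(2)[of u] by blast
    have "norm (f v) \<le> \<bar>C\<bar> * (M * norm u)" if "0 \<le> v" "norm v \<le> M * norm u" for v
    proof -
      have "norm (f v) \<le> C * norm v" by (rule assms(2)[OF that(1)])
      also have "\<dots> \<le> \<bar>C\<bar> * norm v" by (intro mult_right_mono) auto
      also have "\<dots> \<le> \<bar>C\<bar> * (M * norm u)" by (intro mult_left_mono that) auto
      finally show ?thesis .
    qed
    from this[of v] this[of w] vw(1,2,4,5) have "norm (f v) + norm (f w) \<le> norm u * (2 * M * \<bar>C\<bar>)"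
      by (simp add: algebra_simps)
    then show ?thesis
      using norm_triangle_ineq4[of "f v" "f w"] vw(3) linear_diff[OF assms(1)] by simp
  qed
  then show ?thesis
    using assms(1) by (intro bounded_linear_intro) (auto simp: linear_add linear_scale)
qed

section \<open>Resolvents of substochastic semigroups\<close>

locale substochastic_sg =
  fixes T :: "real \<Rightarrow> 'a::abstract_state_space \<Rightarrow> 'a"
  assumes substochastic_semigroup: "substochastic_semigroup T"
begin

lemma bounded_linear_T: "0 \<le> t \<Longrightarrow> bounded_linear (T t)"
  and T_zero: "T 0 u = u"
  and T_add: "0 \<le> s \<Longrightarrow> 0 \<le> t \<Longrightarrow> T (s + t) u = T s (T t u)"
  and T_tendsto_zero: "((\<lambda>t. T t u) \<longlongrightarrow> u) (at_right 0)"
  and T_nonneg: "0 \<le> t \<Longrightarrow> 0 \<le> u \<Longrightarrow> 0 \<le> T t u"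
  and norm_T_le: "0 \<le> t \<Longrightarrow> 0 \<le> u \<Longrightarrow> norm (T t u) \<le> norm u"
  using substochastic_semigroup
  unfolding substochastic_semigroup_def C0_semigroup_def substochastic_def positive_op_def by blast+

lemma linear_T: "0 \<le> t \<Longrightarrow> linear (T t)"
  by (rule bounded_linear.linear[OF bounded_linear_T])

lemma T_commute: "0 \<le> s \<Longrightarrow> 0 \<le> t \<Longrightarrow> T s (T t u) = T t (T s u)"
  by (metis T_add add.commute)

section \<open>Uniform bound, strong continuity and integrals of orbits\<close>

lemma uniformly_bounded:
  obtains M where "0 < M" "\<And>t u. 0 \<le> t \<Longrightarrow> norm (T t u) \<le> M * norm u"
proof -
  obtain M where M: "0 < M"
    "\<And>u::'a. \<exists>v\<ge>0. \<exists>w\<ge>0. u = v - w \<and> norm v \<le> M * norm u \<and> norm w \<le> M * norm u"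
    by (rule bounded_decomposition) (rule that)
  \<comment> \<open>Contractivity holds on the cone; elsewhere the decomposition costs a factor
    \<open>2 M\<close>.\<close>
  have "norm (T t u) \<le> (2 * M) * norm u" if "0 \<le> t" for t u
  proof -
    obtain v w where vw: "0 \<le> v" "0 \<le> w" "u = v - w" "norm v \<le> M * norm u" "norm w \<le> M * norm u"
      using M(2)[of u] by blast
    have "norm (T t u) \<le> norm (T t v) + norm (T t w)"
      using vw(3) linear_diff[OF linear_T[OF that]] norm_triangle_ineq4 by metis
    then show ?thesis using norm_T_le[OF that vw(1)] norm_T_le[OF that vw(2)] vw(4,5) by linarith
  qed
  with M(1) show thesis by (intro that[of "2 * M"]) auto
qed

lemma continuous_on_T: "continuous_on {0..} (\<lambda>t. T t u)"
proof -
  obtain M where M: "0 < M" "\<And>t u. 0 \<le> t \<Longrightarrow> norm (T t u) \<le> M * norm u"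
    by (rule uniformly_bounded) (rule that)
  \<comment> \<open>The difference is the earlier operator applied to
    \<open>T \<bar>t - s\<bar> u - u\<close>, so the uniform bound turns right continuity at
    \<open>0\<close> into two-sided continuity.\<close>
  have diff: "norm (T t u - T s u) \<le> M * norm (T \<bar>t - s\<bar> u - u)" if "0 \<le> s" "0 \<le> t" for s t
  proof -
    have *: "norm (T b u - T a u) \<le> M * norm (T (b - a) u - u)" if "0 \<le> a" "a \<le> b" for a b
      using M(2)[of a "T (b - a) u - u"] T_add[of a "b - a" u] linear_diff[OF linear_T[of a]] that
      by simp
    show ?thesis
      using *[of s t] *[of t s] that by (cases "s \<le> t") (simp_all add: norm_minus_commute)
  qed
  show ?thesis
    unfolding continuous_on_iff
  proof (intro ballI allI impI)
    fix s e :: real assume s: "s \<in> {0..}" and e: "0 < e"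
    have "\<forall>\<^sub>F t in at_right 0. dist (T t u) u < e / M"
      using T_tendsto_zero e M(1) by (simp add: tendsto_iff)
    then obtain d where d: "0 < d" "\<And>t. 0 < t \<Longrightarrow> t < d \<Longrightarrow> dist (T t u) u < e / M"
      unfolding eventually_at_right_field by auto
    have "dist (T t u) (T s u) < e" if "t \<in> {0..}" "dist t s < d" for t
    proof -
      have "norm (T \<bar>t - s\<bar> u - u) < e / M"
        using d(2)[of "\<bar>t - s\<bar>"] that e M(1) T_zero by (cases "t = s") (auto simp: dist_norm)
      then have "M * norm (T \<bar>t - s\<bar> u - u) < e" using M(1) by (simp add: field_simps)
      then show ?thesis using diff[of s t] that s by (simp add: dist_norm)
    qed
    with d(1) show "\<exists>d>0. \<forall>t\<in>{0..}. dist t s < d \<longrightarrow> dist (T t u) (T s u) < e" by blast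
  qed
qed

lemma integrable_T: "0 \<le> a \<Longrightarrow> (\<lambda>s. T s u) integrable_on {a..b}"
  by (intro integrable_continuous_interval continuous_on_subset[OF continuous_on_T]) auto

lemma T_integral:
  assumes "0 \<le> h"
  shows "T h (integral {0..t} (\<lambda>s. T s u)) = integral {0..t} (\<lambda>s. T s (T h u))"
proof -
  have "T h (integral {0..t} (\<lambda>s. T s u)) = integral {0..t} (T h \<circ> (\<lambda>s. T s u))"
    using integral_linear[OF integrable_T bounded_linear_T] assms by simp
  also have "\<dots> = integral {0..t} (\<lambda>s. T s (T h u))"
    by (rule integral_cong) (use assms T_commute in auto)
  finally show ?thesis .
qed

text \<open>\<open>T h\<close> of the integral up to \<open>t\<close> and \<open>T t\<close> of the
  integral up to \<open>h\<close> both equal the integral up to \<open>t + h\<close> less an initial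
  piece. A difference in \<open>h\<close> thus moves onto integrals over
  \<open>[0, h]\<close>.\<close>

lemma integral_T_shift:
  assumes "0 \<le> h" "0 \<le> t"
  shows "T h (integral {0..t} (\<lambda>s. T s u)) =
    integral {0..t} (\<lambda>s. T s u) + T t (integral {0..h} (\<lambda>s. T s u)) - integral {0..h} (\<lambda>s. T s u)"
proof -
  have shift: "T a (integral {0..b} (\<lambda>s. T s u)) =
      integral {0..b + a} (\<lambda>s. T s u) - integral {0..a} (\<lambda>s. T s u)" if "0 \<le> a" "0 \<le> b" for a b
  proof -
    have "T a (integral {0..b} (\<lambda>s. T s u)) = integral {0..b} (\<lambda>s. T (s + a) u)"
      unfolding T_integral[OF that(1)] by (rule integral_cong) (use that T_add in auto)
    also have "\<dots> = integral {a..b + a} (\<lambda>s. T s u)"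
      using integral_shift_real_ivl[where c = a and a = a and b = "b + a" and f = "\<lambda>s. T s u"] by simp
    finally show ?thesis
      using Henstock_Kurzweil_Integration.integral_combine[where a = 0 and c = a and b = "b + a"
          and f = "\<lambda>s. T s u"] integrable_T that
      by (simp add: algebra_simps)
  qed
  show ?thesis using shift[of h t] shift[of t h] assms by (simp add: add.commute)
qed

lemma integral_T_average: "((\<lambda>t. integral {0..t} (\<lambda>s. T s u) /\<^sub>R t) \<longlongrightarrow> u) (at_right 0)"
proof -
  have "((\<lambda>t. integral {0..t} (\<lambda>s. T s u)) has_vector_derivative T 0 u) (at 0 within {0..1})"
    by (rule integral_has_vector_derivative) (auto intro: continuous_on_subset[OF continuous_on_T])
  then have "((\<lambda>t. (1 / norm t) *\<^sub>R (integral {0..t} (\<lambda>s. T s u) - t *\<^sub>R u)) \<longlongrightarrow> 0) (at_right 0)"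
    by (simp add: has_vector_derivative_def has_derivative_within T_zero at_within_Icc_at_right)
  then have "((\<lambda>t. (1 / norm t) *\<^sub>R (integral {0..t} (\<lambda>s. T s u) - t *\<^sub>R u) + u) \<longlongrightarrow> 0 + u) (at_right 0)"
    by (intro tendsto_intros)
  moreover have "\<forall>\<^sub>F t in at_right 0. (1 / norm t) *\<^sub>R (integral {0..t} (\<lambda>s. T s u) - t *\<^sub>R u) + u =
      integral {0..t} (\<lambda>s. T s u) /\<^sub>R t"
    using eventually_at_right_less[of "0::real"]
    by eventually_elim (simp add: scaleR_diff_right divide_inverse)
  ultimately show ?thesis by (simp add: tendsto_cong)
qed

section \<open>The generator and its action on integrated orbits\<close>

lemma generatorI:
  assumes "((\<lambda>t. (T t u - u) /\<^sub>R t) \<longlongrightarrow> v) (at_right 0)"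
  shows "u \<in> Dom (generator T)" "app (generator T) u = v"
  using assms by (auto simp: generator_def intro!: tendsto_Lim)

lemma generatorD:
  assumes "u \<in> Dom (generator T)"
  shows "((\<lambda>t. (T t u - u) /\<^sub>R t) \<longlongrightarrow> app (generator T) u) (at_right 0)"
  using assms generatorI by (auto simp: generator_def)

text \<open>After division by \<open>h\<close>, the shift identity leaves only averages over
  \<open>[0, h]\<close>, which converge to \<open>u\<close>.\<close>

lemma generator_integral:
  assumes "0 \<le> t"
  shows "integral {0..t} (\<lambda>s. T s u) \<in> Dom (generator T)" (is ?in)
    and "app (generator T) (integral {0..t} (\<lambda>s. T s u)) = T t u - u" (is ?eq)
proof -
  let ?J = "\<lambda>t. integral {0..t} (\<lambda>s. T s u)"
  have "((\<lambda>h. T t (?J h /\<^sub>R h) - ?J h /\<^sub>R h) \<longlongrightarrow> T t u - u) (at_right 0)"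
    by (intro tendsto_diff bounded_linear.tendsto[OF bounded_linear_T[OF assms]] integral_T_average)
  moreover have "\<forall>\<^sub>F h in at_right 0. (T h (?J t) - ?J t) /\<^sub>R h = T t (?J h /\<^sub>R h) - ?J h /\<^sub>R h"
    using eventually_at_right_less[of "0::real"]
    by eventually_elim
      (simp only: integral_T_shift[OF less_imp_le assms],
        simp add: linear_scale[OF linear_T[OF assms]] scaleR_diff_right)
  ultimately have "((\<lambda>h. (T h (?J t) - ?J t) /\<^sub>R h) \<longlongrightarrow> T t u - u) (at_right 0)"
    by (simp add: tendsto_cong)
  then show ?in ?eq by (rule generatorI)+
qed

text \<open>All facts on integrated orbits thereby apply to the integrand of the Laplace
  transform.\<close>

lemma exp_scaled:
  assumes "0 \<le> l"
  shows "substochastic_sg (\<lambda>s u. exp (- l * s) *\<^sub>R T s u)"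
proof (unfold_locales, unfold substochastic_semigroup_def C0_semigroup_def substochastic_def positive_op_def,
    intro conjI allI impI)
  fix s t :: real and u
  show "bounded_linear (\<lambda>u. exp (- l * t) *\<^sub>R T t u)" if "0 \<le> t"
    using bounded_linear_T[OF that] bounded_linear_const_scaleR by blast
  show "exp (- l * (s + t)) *\<^sub>R T (s + t) u = exp (- l * s) *\<^sub>R T s (exp (- l * t) *\<^sub>R T t u)"
    if "0 \<le> s" "0 \<le> t"
    using that by (simp add: T_add linear_scale[OF linear_T] exp_add[symmetric] algebra_simps)
  have "((\<lambda>t. exp (- l * t) *\<^sub>R T t u) \<longlongrightarrow> exp (- l * 0) *\<^sub>R u) (at_right 0)"
    by (intro tendsto_intros T_tendsto_zero)
  then show "((\<lambda>t. exp (- l * t) *\<^sub>R T t u) \<longlongrightarrow> u) (at_right 0)" by simp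
  show "0 \<le> exp (- l * t) *\<^sub>R T t u" if "0 \<le> t" "0 \<le> u"
    using that by (simp add: T_nonneg scaleR_nonneg_nonneg)
  show "norm (exp (- l * t) *\<^sub>R T t u) \<le> norm u" if "0 \<le> t" "0 \<le> u"
  proof -
    have "exp (- l * t) \<le> 1" using that assms by simp
    then have "exp (- l * t) * norm (T t u) \<le> 1 * norm u"
      using norm_T_le[OF that] by (intro mult_mono) auto
    then show ?thesis by simp
  qed
qed (simp_all add: T_zero)

text \<open>The Laplace transform of the semigroup, written as a series over unit intervals so that only
  integrals over compact intervals occur.\<close>

definition laplace :: "real \<Rightarrow> 'a \<Rightarrow> 'a" where
  "laplace l u = (\<Sum>k. exp (- l * real k) *\<^sub>R
     T (real k) (integral {0..1} (\<lambda>s. exp (- l * s) *\<^sub>R T s u)))"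

context
  fixes l :: real
  assumes l_pos: "0 < l"
begin

definition W :: "real \<Rightarrow> 'a \<Rightarrow> 'a" where
  "W s u = exp (- l * s) *\<^sub>R T s u"

interpretation W: substochastic_sg W
  using exp_scaled[of l] l_pos by (simp add: W_def[abs_def])

abbreviation (input) J :: "'a \<Rightarrow> 'a" where
  "J u \<equiv> integral {0..1} (\<lambda>s. W s u)"

lemma laplace_eq: "laplace l u = (\<Sum>k. W (real k) (J u))"
  by (simp add: laplace_def W_def)

lemma W_nat_bounded:
  obtains M where "0 < M" "\<And>k u. norm (W (real k) u) \<le> exp (- l) ^ k * (M * norm u)"
proof -
  obtain M where M: "0 < M" "\<And>t u. 0 \<le> t \<Longrightarrow> norm (T t u) \<le> M * norm u"
    by (rule uniformly_bounded) (rule that)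
  have "norm (W (real k) u) \<le> exp (- l) ^ k * (M * norm u)" for k u
    using M(2)[of "real k" u] by (simp add: W_def exp_of_nat_mult[symmetric] algebra_simps)
  with M(1) show thesis by (rule that)
qed

lemma exp_neg_geometric: "summable (\<lambda>k. exp (- l) ^ k * c)"
  using l_pos by (intro summable_mult2 summable_geometric) simp

lemma summable_W: "summable (\<lambda>k. norm (W (real k) u))"
proof -
  obtain M where "\<And>k u. norm (W (real k) u) \<le> exp (- l) ^ k * (M * norm u)"
    by (rule W_nat_bounded) (rule that)
  then show ?thesis
    by (intro summable_comparison_test'[OF exp_neg_geometric[of "M * norm u"], of 0]) simp
qed

lemma laplace_sums: "(\<lambda>k. W (real k) (J u)) sums laplace l u"
  unfolding laplace_eq by (rule summable_sums[OF summable_norm_cancel[OF summable_W]])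

lemma W_laplace:
  assumes h: "0 \<le> h"
  shows "W h (laplace l u) = laplace l u - integral {0..h} (\<lambda>s. W s u)"
proof -
  let ?I = "integral {0..h} (\<lambda>s. W s u)"
  \<comment> \<open>On each unit block \<open>W h\<close> adds an increment of
    \<open>W (real k) ?I\<close>; the increments telescope, and exponential decay removes the upper
    end.\<close>
  have *: "W h (W (real k) (J u)) = W (real k) (J u) + (W (real (Suc k)) ?I - W (real k) ?I)" for k
  proof -
    have "W h (W (real k) (J u)) = W (real k) (W h (J u))" by (rule W.T_commute) (use h in auto)
    also have "\<dots> = W (real k) (J u) + (W (real k) (W 1 ?I) - W (real k) ?I)"
      by (simp only: W.integral_T_shift[OF h zero_le_one])
        (simp add: linear_add[OF W.linear_T] linear_diff[OF W.linear_T])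
    also have "W (real k) (W 1 ?I) = W (real (Suc k)) ?I"
      using W.T_add[of "real k" 1 ?I] by (simp add: add.commute)
    finally show ?thesis .
  qed
  have "(\<lambda>k. W (real k) ?I) \<longlonglongrightarrow> 0"
    by (rule summable_LIMSEQ_zero[OF summable_norm_cancel[OF summable_W]])
  then have "(\<lambda>k. W (real (Suc k)) ?I - W (real k) ?I) sums (0 - W (real 0) ?I)"
    by (rule telescope_sums)
  then have "(\<lambda>k. W h (W (real k) (J u))) sums (laplace l u + (0 - W (real 0) ?I))"
    unfolding * by (intro sums_add laplace_sums)
  moreover have "(\<lambda>k. W h (W (real k) (J u))) sums W h (laplace l u)"
    by (rule bounded_linear.sums[OF W.bounded_linear_T[OF h] laplace_sums])
  ultimately show ?thesis using sums_unique2 by (fastforce simp: W.T_zero)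
qed

lemma laplace_generator_limit:
  "((\<lambda>h. (T h (laplace l u) - laplace l u) /\<^sub>R h) \<longlongrightarrow> l *\<^sub>R laplace l u - u) (at_right 0)"
proof -
  let ?I = "\<lambda>h. integral {0..h} (\<lambda>s. W s u)"
  \<comment> \<open>Writing \<open>T h\<close> as \<open>exp (l * h)\<close> times
    \<open>W h\<close> splits the difference quotient into the derivative of the exponential at
    \<open>0\<close> and an average of the damped orbit.\<close>
  have "((\<lambda>h. exp (l * h)) has_real_derivative l) (at 0)"
    by (auto intro!: derivative_eq_intros)
  then have "((\<lambda>h. (exp (l * h) - 1) / h) \<longlongrightarrow> l) (at 0)" by (simp add: DERIV_def)
  then have "((\<lambda>h. (exp (l * h) - 1) / h) \<longlongrightarrow> l) (at_right 0)"
    by (rule tendsto_mono[OF at_le, rotated]) simp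
  moreover have "((\<lambda>h. exp (l * h)) \<longlongrightarrow> exp (l * 0)) (at_right 0)" by (intro tendsto_intros)
  ultimately have "((\<lambda>h. ((exp (l * h) - 1) / h) *\<^sub>R laplace l u - exp (l * h) *\<^sub>R (?I h /\<^sub>R h))
      \<longlongrightarrow> l *\<^sub>R laplace l u - exp (l * 0) *\<^sub>R u) (at_right 0)"
    by (intro tendsto_intros W.integral_T_average)
  moreover have "\<forall>\<^sub>F h in at_right 0. (T h (laplace l u) - laplace l u) /\<^sub>R h =
      ((exp (l * h) - 1) / h) *\<^sub>R laplace l u - exp (l * h) *\<^sub>R (?I h /\<^sub>R h)"
    using eventually_at_right_less[of "0::real"]
  proof eventually_elim
    case (elim h)
    have "T h (laplace l u) = exp (l * h) *\<^sub>R W h (laplace l u)"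
      by (simp add: W_def exp_add[symmetric])
    also have "\<dots> = exp (l * h) *\<^sub>R laplace l u - exp (l * h) *\<^sub>R ?I h"
      using elim by (simp only: W_laplace less_imp_le scaleR_diff_right)
    finally show ?case
      by (simp add: scaleR_diff_right scaleR_diff_left divide_inverse right_diff_distrib mult.commute)
  qed
  ultimately show ?thesis by (simp add: tendsto_cong)
qed

lemma laplace_nonneg: "0 \<le> u \<Longrightarrow> 0 \<le> laplace l u"
  by (rule sums_cone_nonneg[OF laplace_sums])
    (auto intro!: W.T_nonneg integral_cone_nonneg W.integrable_T)

lemma bounded_linear_laplace: "bounded_linear (laplace l)"
proof -
  obtain M where M: "0 < M" "\<And>k u. norm (W (real k) u) \<le> exp (- l) ^ k * (M * norm u)"
    by (rule W_nat_bounded) (rule that)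
  have J_add: "J (u + v) = J u + J v" for u v
  proof -
    have "J (u + v) = integral {0..1} (\<lambda>s. W s u + W s v)"
      by (rule integral_cong) (simp add: linear_add[OF W.linear_T])
    then show ?thesis by (simp add: Henstock_Kurzweil_Integration.integral_add W.integrable_T)
  qed
  have J_scale: "J (r *\<^sub>R u) = r *\<^sub>R J u" for r u
  proof -
    have "J (r *\<^sub>R u) = integral {0..1} (\<lambda>s. r *\<^sub>R W s u)"
      by (rule integral_cong) (simp add: linear_scale[OF W.linear_T])
    then show ?thesis by simp
  qed
  have "linear (laplace l)"
  proof (rule linearI)
    fix u v :: 'a and r :: real
    have "(\<lambda>k. W (real k) (J u) + W (real k) (J v)) sums (laplace l u + laplace l v)"
      by (intro sums_add laplace_sums)
    then have "(\<lambda>k. W (real k) (J (u + v))) sums (laplace l u + laplace l v)"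
      by (simp add: J_add linear_add[OF W.linear_T])
    then show "laplace l (u + v) = laplace l u + laplace l v"
      using laplace_sums sums_unique2 by blast
    have "(\<lambda>k. r *\<^sub>R W (real k) (J u)) sums (r *\<^sub>R laplace l u)"
      by (intro sums_scaleR_right laplace_sums)
    then have "(\<lambda>k. W (real k) (J (r *\<^sub>R u))) sums (r *\<^sub>R laplace l u)"
      by (simp add: J_scale linear_scale[OF W.linear_T])
    then show "laplace l (r *\<^sub>R u) = r *\<^sub>R laplace l u"
      using laplace_sums sums_unique2 by blast
  qed
  moreover have "norm (laplace l u) \<le> (\<Sum>k. exp (- l) ^ k * M) * norm u" if u: "0 \<le> u" for u
  proof -
    have J: "norm (J u) \<le> norm u"
      using integral_norm_bound_integral[OF W.integrable_T[of 0 u 1], of "\<lambda>_. norm u"]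
        integrable_const_ivl[of "norm u" 0 "1::real"] W.norm_T_le[OF _ u]
      by simp
    have le: "norm (W (real k) (J u)) \<le> exp (- l) ^ k * M * norm u" for k
    proof -
      have "exp (- l) ^ k * (M * norm (J u)) \<le> exp (- l) ^ k * (M * norm u)"
        using J M(1) by (intro mult_left_mono) auto
      from order_trans[OF M(2) this] show ?thesis by (simp only: mult.assoc)
    qed
    have "norm (laplace l u) \<le> (\<Sum>k. norm (W (real k) (J u)))"
      unfolding laplace_eq by (rule summable_norm[OF summable_W])
    also have "\<dots> \<le> (\<Sum>k. exp (- l) ^ k * M * norm u)"
      by (intro suminf_le le summable_W summable_mult2 exp_neg_geometric)
    also have "\<dots> = (\<Sum>k. exp (- l) ^ k * M) * norm u"
      by (rule suminf_mult2[symmetric, OF exp_neg_geometric])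
    finally show ?thesis .
  qed
  ultimately show ?thesis by (rule bounded_linear_if_bounded_on_cone)
qed

lemma T_laplace:
  assumes h: "0 \<le> h"
  shows "T h (laplace l u) = laplace l (T h u)"
proof -
  have "T h (W (real k) (J u)) = W (real k) (J (T h u))" for k
  proof -
    \<comment> \<open>With this factor \<open>T h\<close> becomes \<open>W h\<close>, which commutes
      with the damped semigroup and passes under its integral; the nonzero factor is cancelled
      afterwards.\<close>
    have "exp (- l * h) *\<^sub>R T h (W (real k) (J u)) = exp (- l * h) *\<^sub>R W (real k) (J (T h u))"
    proof -
      have "exp (- l * h) *\<^sub>R T h (W (real k) (J u)) = W (real k) (W h (J u))"
        using W.T_commute[OF h, of "real k"] by (simp add: W_def)
      also have "\<dots> = W (real k) (J (exp (- l * h) *\<^sub>R T h u))"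
        by (simp only: W.T_integral[OF h]) (simp add: W_def)
      also have "J (exp (- l * h) *\<^sub>R T h u) = exp (- l * h) *\<^sub>R J (T h u)"
      proof -
        have "J (exp (- l * h) *\<^sub>R T h u) = integral {0..1} (\<lambda>s. exp (- l * h) *\<^sub>R W s (T h u))"
          by (rule integral_cong) (simp only: linear_scale[OF W.linear_T] atLeastAtMost_iff)
        then show ?thesis by simp
      qed
      finally show ?thesis by (simp add: linear_scale[OF W.linear_T])
    qed
    then show ?thesis by simp
  qed
  then have "(\<lambda>k. W (real k) (J (T h u))) sums T h (laplace l u)"
    using bounded_linear.sums[OF bounded_linear_T[OF h] laplace_sums, of u] by simp
  then show ?thesis using laplace_sums sums_unique2 by blast
qed

section \<open>The Laplace transform as resolvent of the generator\<close>

lemma laplace_in_Dom: "laplace l u \<in> Dom (generator T)"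
  and laplace_right_inverse: "l *\<^sub>R laplace l u - app (generator T) (laplace l u) = u"
  using generatorI[OF laplace_generator_limit] by simp_all

text \<open>Being bounded and commuting with the semigroup, \<open>laplace l\<close> moves through
  the limit defining the generator; comparison with \<open>laplace_generator_limit\<close>
  finishes.\<close>

lemma laplace_left_inverse:
  assumes "u \<in> Dom (generator T)"
  shows "laplace l (l *\<^sub>R u - app (generator T) u) = u"
proof -
  interpret L: bounded_linear "laplace l" by (rule bounded_linear_laplace)
  have "((\<lambda>h. laplace l ((T h u - u) /\<^sub>R h)) \<longlongrightarrow> laplace l (app (generator T) u)) (at_right 0)"
    by (intro L.tendsto generatorD assms)
  moreover have "\<forall>\<^sub>F h in at_right 0.
      laplace l ((T h u - u) /\<^sub>R h) = (T h (laplace l u) - laplace l u) /\<^sub>R h"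
    using eventually_at_right_less[of "0::real"]
    by eventually_elim (simp add: L.scaleR L.diff T_laplace)
  ultimately have "((\<lambda>h. (T h (laplace l u) - laplace l u) /\<^sub>R h) \<longlongrightarrow>
      laplace l (app (generator T) u)) (at_right 0)"
    by (simp add: tendsto_cong)
  from tendsto_unique[OF _ this laplace_generator_limit]
  have "laplace l (app (generator T) u) = l *\<^sub>R laplace l u - u" by simp
  then show ?thesis by (simp add: L.diff L.scaleR)
qed

lemma resolvent_eq_laplace:
  assumes "op_eq A (generator T)"
  shows "resolvent l A = laplace l"
  unfolding resolvent_def
proof (intro ext, rule the_inv_into_f_eq)
  have A: "Dom A = Dom (generator T)" "\<And>u. u \<in> Dom A \<Longrightarrow> app A u = app (generator T) u"
    using assms by (auto simp: op_eq_def)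
  fix u
  show "inj_on (\<lambda>u. l *\<^sub>R u - app A u) (Dom A)"
    by (rule inj_on_inverseI[where g = "laplace l"]) (simp add: A laplace_left_inverse)
  show "laplace l u \<in> Dom A" "l *\<^sub>R laplace l u - app A (laplace l u) = u"
    using laplace_in_Dom laplace_right_inverse by (simp_all add: A)
qed

lemma resolvent_in_Dom: "op_eq A (generator T) \<Longrightarrow> resolvent l A u \<in> Dom A"
  and resolvent_right_inverse:
    "op_eq A (generator T) \<Longrightarrow> l *\<^sub>R resolvent l A u - app A (resolvent l A u) = u"
  and resolvent_left_inverse:
    "op_eq A (generator T) \<Longrightarrow> v \<in> Dom A \<Longrightarrow> resolvent l A (l *\<^sub>R v - app A v) = v"
  and resolvent_nonneg: "op_eq A (generator T) \<Longrightarrow> 0 \<le> u \<Longrightarrow> 0 \<le> resolvent l A u"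
  and bounded_linear_resolvent: "op_eq A (generator T) \<Longrightarrow> bounded_linear (resolvent l A)"
  using laplace_in_Dom laplace_right_inverse laplace_left_inverse laplace_nonneg bounded_linear_laplace
  by (auto simp: resolvent_eq_laplace op_eq_def)

end

end

section \<open>The defect functional\<close>

locale kato_pair =
  fixes A B :: "'a::abstract_state_space operator" and V :: "real \<Rightarrow> 'a \<Rightarrow> 'a"
  assumes kato_conditions: "kato_conditions A B"
    and perturbed_semigroup: "perturbed_semigroup A B V"
begin

sublocale V: substochastic_sg V
  using perturbed_semigroup by unfold_locales (simp add: perturbed_semigroup_def)

abbreviation G :: "'a operator" where "G \<equiv> generator V"

abbreviation R :: "real \<Rightarrow> 'a \<Rightarrow> 'a" where "R l \<equiv> resolvent l A"

abbreviation RG :: "real \<Rightarrow> 'a \<Rightarrow> 'a" where "RG l \<equiv> resolvent l G"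

definition L :: "real \<Rightarrow> 'a \<Rightarrow> 'a" where "L l u = app B (R l u)"

lemma kato_term_eq: "kato_term l A B k u = R l ((L l ^^ k) u)"
  by (simp add: kato_term_def L_def[abs_def])

lemma app_generator: "w \<in> Dom A \<Longrightarrow> w \<in> Dom G \<and> app G w = app A w + app B w"
  using perturbed_semigroup by (auto simp: perturbed_semigroup_def op_extends_def op_add_def)

lemma loss_nonneg: "w \<in> Dom A \<Longrightarrow> 0 \<le> w \<Longrightarrow> 0 \<le> loss A B w"
  using kato_conditions by (force simp: kato_conditions_def op_add_def loss_def)

context
  fixes l :: real
  assumes l_pos: "0 < l"
begin

lemma RG_in_Dom: "RG l u \<in> Dom G"
  and RG_right_inverse: "l *\<^sub>R RG l u - app G (RG l u) = u"
  and RG_left_inverse: "v \<in> Dom G \<Longrightarrow> RG l (l *\<^sub>R v - app G v) = v"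
  and linear_RG: "linear (RG l)"
  using V.resolvent_in_Dom[OF l_pos] V.resolvent_right_inverse[OF l_pos]
    V.resolvent_left_inverse[OF l_pos]
    bounded_linear.linear[OF V.bounded_linear_resolvent[OF l_pos]]
  by (simp_all add: op_eq_def)

lemma R_in_Dom: "R l u \<in> Dom A"
  and R_right_inverse: "l *\<^sub>R R l u - app A (R l u) = u"
  and R_left_inverse: "w \<in> Dom A \<Longrightarrow> R l (l *\<^sub>R w - app A w) = w"
  and R_nonneg: "0 \<le> u \<Longrightarrow> 0 \<le> R l u"
  and linear_R: "linear (R l)"
proof -
  obtain S where S: "substochastic_semigroup S" "op_eq A (generator S)"
    using kato_conditions by (auto simp: kato_conditions_def generates_substochastic_def)
  then interpret S: substochastic_sg S by unfold_locales
  show "R l u \<in> Dom A" "l *\<^sub>R R l u - app A (R l u) = u"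
    "w \<in> Dom A \<Longrightarrow> R l (l *\<^sub>R w - app A w) = w" "0 \<le> u \<Longrightarrow> 0 \<le> R l u" "linear (R l)"
    using S.resolvent_in_Dom[OF l_pos S(2)] S.resolvent_right_inverse[OF l_pos S(2)]
      S.resolvent_left_inverse[OF l_pos S(2)] S.resolvent_nonneg[OF l_pos S(2)]
      bounded_linear.linear[OF S.bounded_linear_resolvent[OF l_pos S(2)]]
    by simp_all
qed

section \<open>The resolvent series and its mass balance\<close>

lemma RG_sums: "(\<lambda>k. R l ((L l ^^ k) u)) sums RG l u"
  using perturbed_semigroup l_pos by (simp add: perturbed_semigroup_def kato_term_eq)

text \<open>Substituting \<open>A R = l R - I\<close> into the loss gives the mass balance of one
  iteration step.\<close>

lemma Psi_L: "Psi (L l u) = Psi u - l * Psi (R l u) - loss A B (R l u)"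
proof -
  have "app A (R l u) = l *\<^sub>R R l u - u" using R_right_inverse[of u] by (simp add: algebra_simps)
  then show ?thesis by (simp add: loss_def L_def Psi_add Psi_diff Psi_scaleR)
qed

lemma linear_L: "linear (L l)"
proof -
  have "Dom A \<subseteq> Dom B" "linear_op B" using kato_conditions by (simp_all add: kato_conditions_def)
  moreover from this(1) have "R l u \<in> Dom B" for u using R_in_Dom by blast
  ultimately show ?thesis
    unfolding L_def by (intro linearI)
      (simp_all add: linear_op_def linear_add[OF linear_R] linear_scale[OF linear_R])
qed

lemma L_nonneg: "0 \<le> u \<Longrightarrow> 0 \<le> L l u"
  using kato_conditions R_in_Dom R_nonneg by (simp add: kato_conditions_def L_def)

lemma Psi_L_le: "0 \<le> u \<Longrightarrow> Psi (L l u) \<le> Psi u"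
  using mult_nonneg_nonneg[OF less_imp_le[OF l_pos] Psi_nonneg[OF R_nonneg[of u]]]
    loss_nonneg[OF R_in_Dom R_nonneg, of u]
  by (simp add: Psi_L)

lemma linear_L_power: "linear (L l ^^ n)"
proof (induction n)
  case (Suc n)
  then show ?case using linear_compose[OF Suc linear_L] by (simp add: o_def)
qed (simp add: linear_ident)

lemma L_power_nonneg: "0 \<le> u \<Longrightarrow> 0 \<le> (L l ^^ n) u"
  by (induction n) (simp_all add: L_nonneg)

text \<open>The mass that is not accounted for by the loss functional.\<close>

definition defect :: "'a \<Rightarrow> real" where
  "defect u = lim (\<lambda>n. Psi ((L l ^^ n) u))"

text \<open>On the cone the masses are nonnegative and decreasing; any other element is a difference
  of two positive ones.\<close>

lemma defect_tendsto: "(\<lambda>n. Psi ((L l ^^ n) u)) \<longlonglongrightarrow> defect u"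
proof -
  have cone: "convergent (\<lambda>n. Psi ((L l ^^ n) u))" if u: "0 \<le> u" for u
  proof -
    have "decseq (\<lambda>n. Psi ((L l ^^ n) u))"
      by (intro decseq_SucI) (simp add: Psi_L_le L_power_nonneg u)
    moreover have "\<forall>n. 0 \<le> Psi ((L l ^^ n) u)" by (simp add: Psi_nonneg L_power_nonneg u)
    ultimately show ?thesis using decseq_convergent unfolding convergent_def by metis
  qed
  obtain v w where vw: "0 \<le> v" "0 \<le> w" "u = v - w" by (rule generating_cone_obtain)
  have "convergent (\<lambda>n. Psi ((L l ^^ n) v) - Psi ((L l ^^ n) w))"
    by (intro convergent_diff cone vw)
  then have "convergent (\<lambda>n. Psi ((L l ^^ n) u))"
    by (simp add: vw(3) linear_diff[OF linear_L_power] Psi_diff)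
  then show ?thesis unfolding defect_def by (simp add: convergent_LIMSEQ_iff)
qed

lemma linear_defect: "linear defect"
proof (rule linearI)
  fix u v :: 'a and r :: real
  have "(\<lambda>n. Psi ((L l ^^ n) (u + v))) \<longlonglongrightarrow> defect u + defect v"
    using tendsto_add[OF defect_tendsto defect_tendsto]
    by (simp add: linear_add[OF linear_L_power] Psi_add)
  then show "defect (u + v) = defect u + defect v" using defect_tendsto LIMSEQ_unique by blast
  have "(\<lambda>n. Psi ((L l ^^ n) (r *\<^sub>R u))) \<longlonglongrightarrow> r * defect u"
    using tendsto_mult[OF tendsto_const defect_tendsto]
    by (simp add: linear_scale[OF linear_L_power] Psi_scaleR)
  then show "defect (r *\<^sub>R u) = r *\<^sub>R defect u"
    using defect_tendsto LIMSEQ_unique unfolding real_scaleR_def by blast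
qed

lemma defect_nonneg: "0 \<le> u \<Longrightarrow> 0 \<le> defect u"
  by (rule LIMSEQ_le_const[OF defect_tendsto]) (auto simp: Psi_nonneg L_power_nonneg)

lemma defect_L: "defect (L l u) = defect u"
proof -
  have "(\<lambda>n. Psi ((L l ^^ n) (L l u))) \<longlonglongrightarrow> defect u"
    using LIMSEQ_Suc[OF defect_tendsto[of u]] by (simp add: funpow_swap1)
  then show ?thesis using defect_tendsto LIMSEQ_unique by blast
qed

text \<open>Invariance keeps \<open>\<phi>\<close> constant along the iterates, while domination
  bounds it there by masses tending to \<open>defect u\<close>.\<close>

lemma defect_maximal:
  assumes inv: "\<And>u. 0 \<le> u \<Longrightarrow> \<phi> (L l u) = \<phi> u" and le: "\<And>u. 0 \<le> u \<Longrightarrow> \<phi> u \<le> Psi u"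
    and u: "0 \<le> u"
  shows "\<phi> u \<le> defect u"
proof -
  have "\<phi> ((L l ^^ n) u) = \<phi> u" for n
    by (induction n) (simp_all add: inv L_power_nonneg u)
  then show ?thesis
    using le[OF L_power_nonneg[OF u]] by (intro LIMSEQ_le_const[OF defect_tendsto]) metis
qed

text \<open>The mass balance telescopes to \<open>Psi u - defect u\<close>, and the resolvent series
  collects the remaining terms into \<open>l * Psi (RG l u)\<close>.\<close>

lemma loss_kato_sums:
  "(\<lambda>k. loss A B (kato_term l A B k u)) sums (Psi u - defect u - l * Psi (RG l u))"
proof -
  have "(\<lambda>k. Psi ((L l ^^ k) u) - Psi ((L l ^^ Suc k) u)) sums (Psi ((L l ^^ 0) u) - defect u)"
    by (rule telescope_sums'[OF defect_tendsto])
  then have "(\<lambda>k. Psi ((L l ^^ k) u) - Psi ((L l ^^ Suc k) u) - l * Psi (R l ((L l ^^ k) u)))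
      sums (Psi ((L l ^^ 0) u) - defect u - l * Psi (RG l u))"
    by (rule sums_diff[OF _ sums_mult[OF bounded_linear.sums[OF Psi_bounded_linear RG_sums]]])
  then show ?thesis by (simp add: kato_term_eq Psi_L)
qed

lemma RG_nonneg: "0 \<le> u \<Longrightarrow> 0 \<le> RG l u"
  by (rule sums_cone_nonneg[OF RG_sums]) (simp add: R_nonneg L_power_nonneg)

lemma defect_le: "0 \<le> u \<Longrightarrow> defect u + l * Psi (RG l u) \<le> Psi u"
  using sums_le[OF _ sums_zero loss_kato_sums, of u]
  by (simp add: kato_term_eq loss_nonneg R_in_Dom R_nonneg L_power_nonneg)

lemma defect_le_Psi: "0 \<le> u \<Longrightarrow> defect u \<le> Psi u"
  using defect_le[of u] Psi_nonneg[OF RG_nonneg, of u] l_pos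
  by (smt (verit) mult_nonneg_nonneg)

text \<open>Continuity permits the limit \<open>t \<rightarrow> 0\<close> in the honesty
  criterion.\<close>

lemma bounded_linear_defect: "bounded_linear defect"
  using defect_le_Psi defect_nonneg
  by (intro bounded_linear_if_bounded_on_cone[where C = 1] linear_defect) (simp add: Psi_positive)

text \<open>For \<open>x = l w - A w\<close> one has \<open>R l x = w\<close>, so the argument is
  \<open>x - L l x\<close>, which invariance annihilates.\<close>

lemma defect_core:
  assumes "w \<in> Dom A"
  shows "defect (l *\<^sub>R w - app A w - app B w) = 0"
  using defect_L[of "l *\<^sub>R w - app A w"]
  by (simp add: L_def R_left_inverse assms linear_diff[OF linear_defect])

text \<open>The right side is \<open>l - G\<close> applied to \<open>R l u\<close>. A linear
  functional is \<open>L\<close>-invariant exactly when it vanishes on these elements; invariance of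
  other functionals is checked in this form.\<close>

lemma diff_L_eq: "u - L l u = l *\<^sub>R R l u - app A (R l u) - app B (R l u)"
  by (simp add: R_right_inverse L_def)

lemma RG_diff_L: "RG l (u - L l u) = R l u"
  using RG_left_inverse[of "R l u"] app_generator[OF R_in_Dom[of u]] by (simp add: diff_L_eq algebra_simps)

end

text \<open>The functionals \<open>\<phi>\<close> and \<open>\<psi>\<close> below are what \<open>defect m\<close> and \<open>defect l\<close> become when \<open>(m - G) v\<close> and
  \<open>(l - G) v\<close> are expressed through each other; each is invariant under the other's iteration and
  dominated by \<open>\<Psi>\<close>, so maximality compares them in both directions.\<close>

lemma defect_generator_less:
  assumes l: "0 < l" and lm: "l < m" and v: "v \<in> Dom G"
  shows "defect m (m *\<^sub>R v - app G v) = defect l (l *\<^sub>R v - app G v)"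
proof -
  have m: "0 < m" using l lm by simp
  note lin = linear_defect[OF l] linear_defect[OF m] linear_RG[OF l] linear_RG[OF m]
  define \<phi> where "\<phi> = (\<lambda>u. defect m (u + (m - l) *\<^sub>R RG l u))"
  define \<psi> where "\<psi> = (\<lambda>u. defect l (u - (m - l) *\<^sub>R RG m u))"
  have lin_\<phi>: "linear \<phi>"
    using linear_compose[OF linear_compose_add[OF linear_ident linear_compose_scale_right[OF lin(3)]] lin(2)]
    by (simp add: \<phi>_def o_def)
  have lin_\<psi>: "linear \<psi>"
    using linear_compose[OF linear_compose_sub[OF linear_ident linear_compose_scale_right[OF lin(4)]] lin(1)]
    by (simp add: \<psi>_def o_def)
  \<comment> \<open>Resolvent identity: the argument is \<open>m - G\<close> applied to
    \<open>RG l u\<close>.\<close>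
  have RG_m: "RG m (u + (m - l) *\<^sub>R RG l u) = RG l u" for u
    using RG_left_inverse[OF m RG_in_Dom[OF l, of u]] RG_right_inverse[OF l, of u]
    by (simp add: algebra_simps)
  \<comment> \<open>Since \<open>RG l\<close> maps \<open>u - L l u\<close> to \<open>R l u\<close>,
    the correction replaces \<open>l\<close> by \<open>m\<close>, leaving
    \<open>(m - A - B) (R l u)\<close>, where \<open>defect m\<close> vanishes.\<close>
  have "\<phi> (u - L l u) = 0" for u
    using defect_core[OF m R_in_Dom[OF l, of u]]
    unfolding \<phi>_def RG_diff_L[OF l] unfolding diff_L_eq[OF l]
    by (simp add: algebra_simps)
  then have \<phi>_L: "\<phi> (L l u) = \<phi> u" for u by (simp add: linear_diff[OF lin_\<phi>])
  have "\<psi> (u - L m u) = 0" for u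
    using defect_core[OF l R_in_Dom[OF m, of u]]
    unfolding \<psi>_def RG_diff_L[OF m] unfolding diff_L_eq[OF m]
    by (simp add: algebra_simps)
  then have \<psi>_L: "\<psi> (L m u) = \<psi> u" for u by (simp add: linear_diff[OF lin_\<psi>])
  have \<phi>_le: "\<phi> u \<le> defect l u" if "0 \<le> u" for u
  proof (rule defect_maximal[where \<phi> = \<phi>, OF l \<phi>_L _ that])
    fix u :: 'a assume u: "0 \<le> u"
    have v: "0 \<le> RG l u" by (rule RG_nonneg[OF l u])
    \<comment> \<open>The term \<open>m * Psi (RG l u)\<close> from \<open>defect_le\<close>
      outweighs the added mass \<open>(m - l) * Psi (RG l u)\<close>.\<close>
    then have "\<phi> u + m * Psi (RG l u) \<le> Psi (u + (m - l) *\<^sub>R RG l u)"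
      using defect_le[OF m, of "u + (m - l) *\<^sub>R RG l u"] u lm
      by (simp add: \<phi>_def RG_m scaleR_nonneg_nonneg)
    then have "\<phi> u \<le> Psi u - l * Psi (RG l u)"
      by (simp only: Psi_add Psi_scaleR) (simp add: algebra_simps)
    then show "\<phi> u \<le> Psi u" using mult_nonneg_nonneg[OF less_imp_le[OF l] Psi_nonneg[OF v]] by simp
  qed
  have \<psi>_le: "\<psi> u \<le> defect m u" if "0 \<le> u" for u
  proof (rule defect_maximal[where \<phi> = \<psi>, OF m \<psi>_L _ that])
    fix u :: 'a assume u: "0 \<le> u"
    \<comment> \<open>The argument of \<open>defect l\<close> in \<open>\<psi>\<close> is not known
      to be positive; linearity lets the subtracted term be dropped because its defect is
      nonnegative.\<close>
    have "0 \<le> defect l ((m - l) *\<^sub>R RG m u)"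
      using lm by (intro defect_nonneg[OF l] scaleR_nonneg_nonneg RG_nonneg[OF m] u) simp
    then show "\<psi> u \<le> Psi u" using defect_le_Psi[OF l u] by (simp add: \<psi>_def linear_diff[OF lin(1)])
  qed
  have "\<phi> u = defect l u" for u
  proof (rule linear_eq_on_cone[OF lin_\<phi> lin(1)])
    fix u :: 'a assume u: "0 \<le> u"
    \<comment> \<open>At this element the corrections cancel by the resolvent identity, so
      \<open>\<psi>\<close> equals \<open>defect l u\<close> there and its bound is the reverse
      inequality.\<close>
    have "0 \<le> u + (m - l) *\<^sub>R RG l u"
      using u lm by (intro add_nonneg_nonneg scaleR_nonneg_nonneg RG_nonneg[OF l]) auto
    from \<psi>_le[OF this] have "defect l u \<le> \<phi> u" by (simp add: \<psi>_def \<phi>_def RG_m)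
    with \<phi>_le[OF u] show "\<phi> u = defect l u" by simp
  qed
  from this[of "l *\<^sub>R v - app G v"] show ?thesis
    by (simp add: \<phi>_def RG_left_inverse[OF l v] algebra_simps)
qed

lemma defect_generator:
  assumes "0 < l" "0 < m" "v \<in> Dom G"
  shows "defect m (m *\<^sub>R v - app G v) = defect l (l *\<^sub>R v - app G v)"
  using defect_generator_less[of l m v] defect_generator_less[of m l v] assms
  by (cases l m rule: linorder_cases) auto

section \<open>Honesty in terms of the defect\<close>

lemma loss_ext_eq:
  assumes l: "0 < l" and v: "v \<in> Dom G"
  shows "loss_ext A B V v = - Psi (app G v) - defect l (l *\<^sub>R v - app G v)"
  unfolding loss_ext_def
proof (rule the_equality)
  \<comment> \<open>The definite description needs one value for all parameters;
    \<open>defect_generator\<close> supplies it.\<close>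
  show sums: "\<forall>m>0. \<forall>u. v = RG m u \<longrightarrow>
    (\<lambda>k. loss A B (kato_term m A B k u)) sums (- Psi (app G v) - defect l (l *\<^sub>R v - app G v))"
  proof (intro allI impI)
    fix m :: real and u assume m: "0 < m" and vu: "v = RG m u"
    have u: "u = m *\<^sub>R v - app G v" using RG_right_inverse[OF m] vu by simp
    have "Psi u - defect m u - m * Psi (RG m u) = - Psi (app G v) - defect l (l *\<^sub>R v - app G v)"
      using defect_generator[OF l m v] by (simp add: u RG_left_inverse[OF m v] Psi_diff Psi_scaleR)
    with loss_kato_sums[OF m, of u]
    show "(\<lambda>k. loss A B (kato_term m A B k u)) sums
      (- Psi (app G v) - defect l (l *\<^sub>R v - app G v))" by simp
  qed
  fix r assume "\<forall>m>0. \<forall>u. v = RG m u \<longrightarrow> (\<lambda>k. loss A B (kato_term m A B k u)) sums r"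
  with sums l RG_left_inverse[OF l v] show "r = - Psi (app G v) - defect l (l *\<^sub>R v - app G v)"
    by (metis sums_unique2)
qed

lemma honest_iff_defect_zero:
  assumes l: "0 < l"
  shows "honest A B V \<longleftrightarrow> (\<forall>u\<ge>0. defect l u = 0)"
proof -
  let ?J = "\<lambda>t u. integral {0..t} (\<lambda>s. V s u)"
  \<comment> \<open>\<open>G\<close> maps the integrated orbit to \<open>V t u - u\<close>, so
    honesty says that the defect vanishes at \<open>l - G\<close> applied to integrated
    orbits.\<close>
  have honest: "honest A B V \<longleftrightarrow>
    (\<forall>t\<ge>0. \<forall>u\<ge>0. defect l (l *\<^sub>R ?J t u - (V t u - u)) = 0)"
  proof -
    have "norm (V t u) - norm u = - loss_ext A B V (?J t u) \<longleftrightarrow>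
        defect l (l *\<^sub>R ?J t u - (V t u - u)) = 0" if "0 \<le> t" "0 \<le> u" for t u
    proof -
      have "norm (V t u) - norm u = Psi (V t u - u)"
        using that by (simp add: Psi_diff Psi_positive V.T_nonneg)
      then show ?thesis
        using loss_ext_eq[OF l V.generator_integral(1)[OF that(1), of u]]
          V.generator_integral(2)[OF that(1), of u] by auto
    qed
    then show ?thesis by (auto simp: honest_def)
  qed
  interpret d: bounded_linear "defect l" by (rule bounded_linear_defect[OF l])
  show ?thesis
  proof
    assume "\<forall>u\<ge>0. defect l u = 0"
    then have zero: "\<And>u. 0 \<le> u \<Longrightarrow> defect l u = 0" by blast
    have "defect l u = 0" for u
      by (rule linear_eq_on_cone[OF linear_defect[OF l] linear_zero zero])
    then show "honest A B V" by (simp add: honest)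
  next
    assume h: "honest A B V"
    show "\<forall>u\<ge>0. defect l u = 0"
    proof (intro allI impI)
      fix u :: 'a assume u: "0 \<le> u"
      \<comment> \<open>This start is positive and in the domain of \<open>G\<close>, so dividing by
        \<open>t\<close> and letting \<open>t \<rightarrow> 0\<close> yields the defect of
        \<open>(l - G) v = u\<close>.\<close>
      define v where "v = RG l u"
      have v: "0 \<le> v" "v \<in> Dom G" "l *\<^sub>R v - app G v = u"
        using RG_nonneg[OF l u] RG_in_Dom[OF l] RG_right_inverse[OF l] by (simp_all add: v_def)
      have "((\<lambda>t. defect l (l *\<^sub>R (?J t v /\<^sub>R t) - (V t v - v) /\<^sub>R t)) \<longlongrightarrow>
          defect l (l *\<^sub>R v - app G v)) (at_right 0)"
        by (intro d.tendsto tendsto_intros V.integral_T_average V.generatorD v)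
      moreover have "\<forall>\<^sub>F t in at_right 0. defect l (l *\<^sub>R (?J t v /\<^sub>R t) - (V t v - v) /\<^sub>R t) = 0"
        using eventually_at_right_less[of "0::real"]
      proof eventually_elim
        case (elim t)
        have "l *\<^sub>R (?J t v /\<^sub>R t) - (V t v - v) /\<^sub>R t = (l *\<^sub>R ?J t v - (V t v - v)) /\<^sub>R t"
          by (simp add: scaleR_diff_right)
        then show ?case using h v(1) elim by (simp add: honest d.scaleR)
      qed
      ultimately have "((\<lambda>t::real. 0) \<longlongrightarrow> defect l (l *\<^sub>R v - app G v)) (at_right 0)"
        by (rule Lim_transform_eventually)
      from tendsto_unique[OF _ this tendsto_const] show "defect l u = 0" by (simp add: v(3))
    qed
  qed
qed

end

section \<open>Bounded positive perturbations\<close>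

theorem proposition4p2:
  fixes A B :: "'a::abstract_state_space operator"
    and K :: "'a \<Rightarrow> 'a"
    and V V\<^sub>K :: "real \<Rightarrow> 'a \<Rightarrow> 'a"
  assumes "kato_conditions A B"
    and "perturbed_semigroup A B V"
    and "dishonest A B V"
    and "bounded_linear K" and "positive_op K"
    and "generates_substochastic (op_diff_bounded A K)"
    and "perturbed_semigroup (op_diff_bounded A K) B V\<^sub>K"
  shows "dishonest (op_diff_bounded A K) B V\<^sub>K"
proof
  assume honest_K: "honest (op_diff_bounded A K) B V\<^sub>K"
  interpret P: kato_pair A B V by unfold_locales (fact assms(1,2))+
  interpret Q: kato_pair "op_diff_bounded A K" B V\<^sub>K
    by unfold_locales (fact kato_conditions_diff_bounded[OF assms(1,4-6)] assms(7))+
  interpret K: bounded_linear K by (fact assms(4))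
  have K_nonneg: "0 \<le> K u" if "0 \<le> u" for u
    using assms(5) that by (simp add: positive_op_def)
  obtain k where k: "0 < k" "\<And>u. norm (K u) \<le> norm u * k" using K.pos_bounded by blast
  \<comment> \<open>As \<open>l * Psi (Q.RG l u) \<le> Psi u\<close> on the cone, twice a bound of
    \<open>K\<close> makes \<open>?S\<close> at least halve the mass.\<close>
  define l where "l = 2 * k"
  have l: "0 < l" using k by (simp add: l_def)
  let ?c = "P.defect l" and ?S = "\<lambda>u. K (Q.RG l u)"
  note lin = P.linear_defect[OF l] Q.linear_RG[OF l]
  have S_nonneg: "0 \<le> ?S u" if "0 \<le> u" for u
    by (intro K_nonneg Q.RG_nonneg[OF l] that)
  define \<phi> where "\<phi> = (\<lambda>u. ?c (u - ?S u))"
  have lin_\<phi>: "linear \<phi>"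
    using linear_compose[OF linear_compose_sub[OF linear_ident linear_compose[OF lin(2) K.linear]] lin(1)]
    by (simp add: \<phi>_def o_def)
  \<comment> \<open>For \<open>w = Q.R l u\<close>, the element \<open>u - Q.L l u\<close> is
    \<open>(l - A + K - B) w\<close>, and \<open>?S\<close> maps it to \<open>K w\<close>. The terms
    in \<open>K\<close> cancel, leaving an argument where \<open>?c\<close> vanishes.\<close>
  have \<phi>_L: "\<phi> (Q.L l u) = \<phi> u" for u
  proof -
    let ?w = "Q.R l u"
    have "?w \<in> Dom A" using Q.R_in_Dom[OF l] by (simp add: op_diff_bounded_def)
    then have "?c (l *\<^sub>R ?w - app A ?w - app B ?w) = 0" by (rule P.defect_core[OF l])
    then have "\<phi> (u - Q.L l u) = 0"
      unfolding \<phi>_def Q.RG_diff_L[OF l] unfolding Q.diff_L_eq[OF l]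
      by (simp add: op_diff_bounded_def algebra_simps)
    then show ?thesis by (simp add: linear_diff[OF lin_\<phi>])
  qed
  \<comment> \<open>Positivity of \<open>K\<close> makes the subtracted defect nonnegative.\<close>
  have \<phi>_le: "\<phi> u \<le> Psi u" if "0 \<le> u" for u
    using P.defect_le_Psi[OF l that] P.defect_nonneg[OF l S_nonneg[OF that]]
    by (simp add: \<phi>_def linear_diff[OF lin(1)])
  \<comment> \<open>Honesty makes the defect of the pair \<open>A - K, B\<close> zero, so maximality
    forces \<open>\<phi> u \<le> 0\<close>.\<close>
  have c_le: "?c u \<le> ?c (?S u)" if "0 \<le> u" for u
    using Q.defect_maximal[OF l \<phi>_L \<phi>_le that] Q.honest_iff_defect_zero[OF l] honest_K that
    by (simp add: \<phi>_def linear_diff[OF lin(1)])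
  have S_half: "Psi (?S u) \<le> 1/2 * Psi u" if u: "0 \<le> u" for u
  proof -
    have "Psi (?S u) \<le> k * Psi (Q.RG l u)"
      using k(2)[of "Q.RG l u"] S_nonneg[OF u] Q.RG_nonneg[OF l u] by (simp add: Psi_positive mult.commute)
    also have "\<dots> = 1/2 * (l * Psi (Q.RG l u))" by (simp add: l_def)
    also have "\<dots> \<le> 1/2 * Psi u"
      using Q.defect_le[OF l u] Q.defect_nonneg[OF l u] by (intro mult_left_mono) auto
    finally show ?thesis .
  qed
  have c_pow: "?c u \<le> (1/2)^n * Psi u" if "0 \<le> u" for u n
    using that
  proof (induction n arbitrary: u)
    case 0
    then show ?case using P.defect_le_Psi[OF l] by simp
  next
    case (Suc n)
    have "?c u \<le> (1/2)^n * Psi (?S u)"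
      using c_le[OF Suc.prems] Suc.IH[OF S_nonneg[OF Suc.prems]] by simp
    also have "\<dots> \<le> (1/2)^n * (1/2 * Psi u)" by (intro mult_left_mono S_half Suc.prems) simp
    finally show ?case by simp
  qed
  have "?c u = 0" if u: "0 \<le> u" for u
  proof (rule antisym)
    have "(\<lambda>n. (1/2)^n * Psi u) \<longlonglongrightarrow> 0"
      by (rule tendsto_mult_left_zero) (simp add: LIMSEQ_power_zero)
    then show "?c u \<le> 0" using c_pow[OF u] by (intro LIMSEQ_le_const) auto
  qed (rule P.defect_nonneg[OF l u])
  then have "honest A B V" using P.honest_iff_defect_zero[OF l] by blast
  with assms(3) show False ..
qed

end
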